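(* Let $G$ be a finite simple graph with $\nu_G$ vertices and $\varepsilon_G$ edges, and let $\omega:E(G)\to\mathbb{C}$ be a weight function. Define the weight function $\omega_x$ by $\omega_x(e)=x^{\omega(e)}$ (a function of a variable $x$). Let $f(\lambda,\mu)$, $g(\lambda,\mu)$, $h(\lambda,\mu)$ be partially differentiable functions such that $f(\alpha,\beta)=0$ and $g(\alpha,\beta)+h(\alpha,\beta)=0$ for some $\alpha,\beta$. Let $$\Phi_{G_{\omega_x}}(\lambda,\mu)=\det\big[f(\lambda,\mu)I+g(\lambda,\mu)\mathcal{D}(G_{\omega_x})+h(\lambda,\mu)\mathcal{A}(G_{\omega_x})\big],$$ regarded as a function of $(\lambda,\mu,x)$. Then $$\frac{\partial^2\Phi_{G_{\omega_x}}}{\partial x\,\partial\lambda}(\alpha,\beta,1)=g(\alpha,\beta)^{\nu_G-1}\big[g_\lambda(\alpha,\beta)+h_\lambda(\alpha,\beta)\big]2\omega(G)\kappa(G)+g(\alpha,\beta)^{\nu_G-1}\big[f_\lambda(\alpha,\beta)\nu_G+(g_\lambda(\alpha,\beta)+h_\lambda(\alpha,\beta))2\varepsilon_G\big]\kappa_\sigma(G_\omega),$$ and $$\frac{\partial^2\Phi_{G_{\omega_x}}}{\partial x\,\partial\mu}(\alpha,\beta,1)=g(\alpha,\beta)^{\nu_G-1}\big[g_\mu(\alpha,\beta)+h_\mu(\alpha,\beta)\big]2\omega(G)\kappa(G)+g(\alpha,\beta)^{\nu_G-1}\big[f_\mu(\alpha,\beta)\nu_G+(g_\mu(\alpha,\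beta)+h_\mu(\alpha,\beta))2\varepsilon_G\big]\kappa_\sigma(G_\omega).$$
   Context: For a weight function $\omega'$ on $E(G)$, $\mathcal{A}(G_{\omega'})=(w_{ij})$ with $w_{ij}=\omega'(e)$ if $e=\{v_i,v_j\}\in E(G)$ and $0$ otherwise; $\mathcal{D}(G_{\omega'})$ is diagonal with $(i,i)$ entry the sum of the weights of edges incident to $v_i$. $\omega(G)=\sum_{e\in E(G)}\omega(e)$. $\kappa(G)$ is the number of spanning trees of $G$. The sigma weighted complexity is $\kappa_\sigma(G_\omega)=\sum_{T}\sum_{e\in E(T)}\omega(e)$, the outer sum over all spanning trees $T$ of $G$. Subscripts $\lambda,\mu$ on $f,g,h$ denote partial derivatives. *)

theory Defs
  imports "HOL-Analysis.Analysis"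
begin

text \<open>
  A finite simple graph has vertex set \<open>UNIV :: 'v set\<close> for a finite type \<open>'v\<close>
  and an edge set of two-element vertex sets. Weight functions are total, but only their
  values on the edge set are ever used.
\<close>

definition simple_graph :: "'v::finite set set \<Rightarrow> bool" where
  "simple_graph E \<longleftrightarrow> (\<forall>e\<in>E. card e = 2)"

definition adj_rel :: "'v set set \<Rightarrow> ('v \<times> 'v) set" where
  "adj_rel E = {(u, v). {u, v} \<in> E}"

definition graph_connected :: "'v set set \<Rightarrow> bool" where
  "graph_connected E \<longleftrightarrow> (\<forall>u v. (u, v) \<in> (adj_rel E)\<^sup>*)"

text \<open>A cycle is listed by its pairwise distinct vertices, without repeating the first one.\<close>

definition is_cycle :: "'v set set \<Rightarrow> 'v list \<Rightarrow> bool" where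
  "is_cycle E p \<longleftrightarrow> 3 \<le> length p \<and> distinct p \<and>
     (\<forall>i<length p. {p ! i, p ! (Suc i mod length p)} \<in> E)"

definition graph_acyclic :: "'v set set \<Rightarrow> bool" where
  "graph_acyclic E \<longleftrightarrow> (\<nexists>p. is_cycle E p)"

text \<open>Spanning trees are identified with their edge sets, as they contain all vertices.\<close>

definition spanning_trees :: "'v::finite set set \<Rightarrow> 'v set set set" where
  "spanning_trees E = {T. T \<subseteq> E \<and> graph_connected T \<and> graph_acyclic T}"

definition complexity :: "'v::finite set set \<Rightarrow> nat" where
  "complexity E = card (spanning_trees E)"

definition sigma_complexity :: "'v::finite set set \<Rightarrow> ('v set \<Rightarrow> complex) \<Rightarrow> complex" where
  "sigma_complexity E w = (\<Sum>T\<in>spanning_trees E. \<Sum>e\<in>T. w e)"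

definition total_weight :: "'v::finite set set \<Rightarrow> ('v set \<Rightarrow> complex) \<Rightarrow> complex" where
  "total_weight E w = (\<Sum>e\<in>E. w e)"

definition weighted_adj :: "'v::finite set set \<Rightarrow> ('v set \<Rightarrow> complex) \<Rightarrow> complex^'v^'v" where
  "weighted_adj E w = (\<chi> i j. if {i, j} \<in> E then w {i, j} else 0)"

definition weighted_deg :: "'v::finite set set \<Rightarrow> ('v set \<Rightarrow> complex) \<Rightarrow> complex^'v^'v" where
  "weighted_deg E w = (\<chi> i j. if i = j then (\<Sum>e | e \<in> E \<and> i \<in> e. w e) else 0)"

text \<open>Complex powers use the principal branch, which is holomorphic near \<open>x = 1\<close>.\<close>

definition power_weight :: "('v set \<Rightarrow> complex) \<Rightarrow> complex \<Rightarrow> 'v set \<Rightarrow> complex" where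
  "power_weight w x e = x powr w e"

text \<open>The scalar multiple \<open>c M\<close> of a matrix is \<open>map_matrix ((*) c) M\<close>.\<close>

definition gen_charfun ::
  "(complex \<Rightarrow> complex \<Rightarrow> complex) \<Rightarrow> (complex \<Rightarrow> complex \<Rightarrow> complex) \<Rightarrow> (complex \<Rightarrow> complex \<Rightarrow> complex)
   \<Rightarrow> 'v::finite set set \<Rightarrow> ('v set \<Rightarrow> complex) \<Rightarrow> complex \<Rightarrow> complex \<Rightarrow> complex" where
  "gen_charfun f g h E w l m =
     det (map_matrix ((*) (f l m)) (mat 1) + map_matrix ((*) (g l m)) (weighted_deg E w)
          + map_matrix ((*) (h l m)) (weighted_adj E w))"

definition partially_differentiable_on ::
  "(complex \<Rightarrow> complex \<Rightarrow> complex) \<Rightarrow> (complex \<times> complex) set \<Rightarrow> bool" where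
  "partially_differentiable_on f S \<longleftrightarrow>
     (\<forall>(l, m)\<in>S. (\<lambda>l. f l m) field_differentiable at l \<and> (\<lambda>m. f l m) field_differentiable at m)"

definition pderiv1 :: "(complex \<Rightarrow> complex \<Rightarrow> complex) \<Rightarrow> complex \<Rightarrow> complex \<Rightarrow> complex" where
  "pderiv1 f a b = deriv (\<lambda>l. f l b) a"

definition pderiv2 :: "(complex \<Rightarrow> complex \<Rightarrow> complex) \<Rightarrow> complex \<Rightarrow> complex \<Rightarrow> complex" where
  "pderiv2 f a b = deriv (\<lambda>m. f a m) b"

text \<open>
  \<open>has_mixed_partial F D a b\<close>: the iterated partial derivative
  \<open>\<partial>/\<partial>x (\<partial>/\<partial>y F(y, x))\<close> exists at \<open>y = a\<close>, \<open>x = b\<close> and equals \<open>D\<close>. The first conjunct is needed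
  because \<open>deriv\<close> is a total function.
\<close>

definition has_mixed_partial ::
  "(complex \<Rightarrow> complex \<Rightarrow> complex) \<Rightarrow> complex \<Rightarrow> complex \<Rightarrow> complex \<Rightarrow> bool" where
  "has_mixed_partial F D a b \<longleftrightarrow>
     (\<forall>\<^sub>F x in nhds b. (\<lambda>y. F y x) field_differentiable at a) \<and>
     ((\<lambda>x. deriv (\<lambda>y. F y x) a) has_field_derivative D) (at b)"

end

theory Submission
  imports Defs "HOL-Library.Transitive_Closure_Table"
begin

text \<open>
  At \<open>(\<alpha>, \<beta>)\<close> the matrix is \<open>g L\<close> with \<open>L\<close> the weighted Laplacian, whose rows sum to zero.
  Differentiating the determinant row by row therefore turns each row of the derivative matrix into
  its row sum times a principal minor of \<open>g L\<close>. By the weighted matrix-tree theorem every such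
  minor is \<open>g ^ (n - 1)\<close> times the sum over spanning trees of the products of edge weights, and it
  remains to differentiate this expression at \<open>x = 1\<close>.

  For the matrix-tree theorem, expand the determinant multilinearly in its rows
  \<open>\<Sum>j. w {i, j} (e i - e j)\<close>. The terms are indexed by functions \<open>\<phi>\<close> fixing the root, and
  contribute only when iterating \<open>\<phi>\<close> leads from every vertex to the root; such functions are the
  parent functions of the spanning trees.
\<close>

section \<open>Determinants\<close>

lemma det_eq_0_if_kernel:
  fixes A :: "'a::field^'n^'n"
  assumes "A *v x = 0" and "x \<noteq> 0"
  shows "det A = 0"
proof (rule ccontr)
  assume "det A \<noteq> 0"
  then obtain B where "B ** A = mat 1"
    using invertible_det_nz[of A] unfolding invertible_def by blast
  then have "x = B *v (A *v x)"
    by (simp add: matrix_vector_mul_assoc)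
  with assms show False
    by simp
qed

text \<open>The product rule differentiates one factor of each Leibniz term at a time; interchanging
  the sums collects the terms by the row of that factor.\<close>

lemma has_field_derivative_det:
  fixes A :: "'a::real_normed_field \<Rightarrow> 'a^'n^'n"
  assumes "\<And>i j. ((\<lambda>t. A t $ i $ j) has_field_derivative A' $ i $ j) (at z)"
  shows "((\<lambda>t. det (A t)) has_field_derivative
           (\<Sum>i\<in>UNIV. det (\<chi> k. if k = i then A' $ k else A z $ k))) (at z)"
proof -
  let ?P = "{p. p permutes (UNIV :: 'n set)}"
  have row: "(\<Prod>k\<in>UNIV. (\<chi> k. if k = i then A' $ k else A z $ k) $ k $ p k)
      = A' $ i $ p i * (\<Prod>k\<in>UNIV - {i}. A z $ k $ p k)" for p i
    by (subst prod.remove[of _ i]) (auto intro!: prod.cong)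
  have "((\<lambda>t. det (A t)) has_field_derivative
      (\<Sum>p\<in>?P. of_int (sign p) * (\<Sum>i\<in>UNIV. A' $ i $ p i * (\<Prod>k\<in>UNIV - {i}. A z $ k $ p k)))) (at z)"
    unfolding det_def
    by (intro DERIV_sum DERIV_cmult has_field_derivative_prod assms)
  also have "(\<Sum>p\<in>?P. of_int (sign p) * (\<Sum>i\<in>UNIV. A' $ i $ p i * (\<Prod>k\<in>UNIV - {i}. A z $ k $ p k)))
      = (\<Sum>i\<in>UNIV. det (\<chi> k. if k = i then A' $ k else A z $ k))"
    unfolding det_def row by (subst sum.swap) (simp add: sum_distrib_left)
  finally show ?thesis .
qed

text \<open>By linearity in row \<open>i\<close>, split \<open>b\<close> into a vector of sum zero
  and a multiple of \<open>axis i 1\<close>. With the first part in row \<open>i\<close>, all row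
  sums vanish, so the all-ones vector lies in the kernel. The determinant left over is the principal
  minor at \<open>i\<close>.\<close>

lemma det_replace_row_zero_sums:
  fixes M :: "'a::field^'n^'n"
  assumes "\<And>k. k \<noteq> i \<Longrightarrow> (\<Sum>j\<in>UNIV. M $ k $ j) = 0"
  shows "det (\<chi> k. if k = i then b else M $ k)
       = (\<Sum>j\<in>UNIV. b $ j) * det (\<chi> k. if k = i then axis i 1 else M $ k)"
proof -
  define s where "s = (\<Sum>j\<in>UNIV. b $ j)"
  let ?N = "(\<chi> k. if k = i then b - s *s axis i 1 else M $ k) :: 'a^'n^'n"
  have "(\<Sum>j\<in>UNIV. (b - s *s axis i 1) $ j) = 0"
    by (simp add: sum_subtractf s_def axis_def if_distrib[of "(*) _"] cong: if_cong)
  then have "?N *v (\<chi> j. 1) = 0"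
    by (auto simp: vec_eq_iff matrix_vector_mult_def assms)
  moreover have "(\<chi> j. 1) \<noteq> (0 :: 'a^'n)"
    by (simp add: vec_eq_iff)
  ultimately have N: "det ?N = 0"
    by (rule det_eq_0_if_kernel)
  have "det (\<chi> k. if k = i then b else M $ k)
      = det (\<chi> k. if k = i then (b - s *s axis i 1) + s *s axis i 1 else M $ k)"
    by (simp only: diff_add_cancel)
  also have "\<dots> = det ?N + det (\<chi> k. if k = i then s *s axis i 1 else M $ k)"
    by (rule det_row_add)
  also have "\<dots> = s * det (\<chi> k. if k = i then axis i 1 else M $ k)"
    unfolding N by (simp add: det_row_mul)
  finally show ?thesis
    unfolding s_def .
qed

section \<open>Rooted parent functions\<close>

text \<open>A spanning tree oriented towards \<open>r\<close>, with \<open>\<phi> v\<close> as the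
  parent of \<open>v\<close>. Making the root its own parent leaves no freedom at \<open>r\<close>,
  so that a tree determines its function.\<close>

definition rooted_at :: "'v \<Rightarrow> ('v \<Rightarrow> 'v) \<Rightarrow> bool" where
  "rooted_at r \<phi> \<longleftrightarrow> \<phi> r = r \<and> (\<forall>v. \<exists>n. (\<phi> ^^ n) v = r)"

text \<open>The root is left out, as it would contribute the singleton \<open>{r}\<close>.\<close>

definition parent_edges :: "'v \<Rightarrow> ('v \<Rightarrow> 'v) \<Rightarrow> 'v set set" where
  "parent_edges r \<phi> = (\<lambda>v. {v, \<phi> v}) ` (- {r})"

text \<open>The depth is the least number of iterations leading to \<open>r\<close>. It is the
  measure for the inductions and extremal arguments below.\<close>

lemma rooted_at_depthE:
  assumes "rooted_at r \<phi>"
  obtains d :: "'v \<Rightarrow> nat" where "\<And>v. v \<noteq> r \<Longrightarrow> d (\<phi> v) < d v"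
proof
  let ?d = "\<lambda>v. LEAST n. (\<phi> ^^ n) v = r"
  fix v assume "v \<noteq> r"
  obtain n where "(\<phi> ^^ n) v = r"
    using assms unfolding rooted_at_def by blast
  then have reach: "(\<phi> ^^ ?d v) v = r"
    by (rule LeastI)
  with \<open>v \<noteq> r\<close> obtain m where m: "?d v = Suc m"
    by (cases "?d v") auto
  with reach have "(\<phi> ^^ m) (\<phi> v) = r"
    by (simp add: funpow_swap1)
  then have "?d (\<phi> v) \<le> m"
    by (rule Least_le)
  with m show "?d (\<phi> v) < ?d v"
    by simp
qed

lemma rooted_at_if_depth:
  fixes d :: "'v \<Rightarrow> nat"
  assumes "\<phi> r = r" and d: "\<And>v. v \<noteq> r \<Longrightarrow> d (\<phi> v) < d v"
  shows "rooted_at r \<phi>"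
proof -
  have "\<exists>n. (\<phi> ^^ n) v = r" for v
  proof (induction "d v" arbitrary: v rule: less_induct)
    case less
    show ?case
    proof (cases "v = r")
      case True
      then show ?thesis by (intro exI[of _ 0]) simp
    next
      case False
      then obtain n where "(\<phi> ^^ n) (\<phi> v) = r"
        using less d by blast
      then show ?thesis
        by (intro exI[of _ "Suc n"]) (simp add: funpow_swap1)
    qed
  qed
  with assms show ?thesis
    unfolding rooted_at_def by blast
qed

section \<open>Determinants with rows selected by a parent function\<close>

text \<open>The rows in \<open>X\<close> are turned into unit vectors one by one, parents before
  children, until the identity matrix remains. The general \<open>X\<close> serves this induction;
  the case of interest is \<open>- {r}\<close>.\<close>

lemma det_rooted:
  fixes \<phi> :: "'v::finite \<Rightarrow> 'v"
  assumes "rooted_at r \<phi>" and "r \<notin> X"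
  shows "det (\<chi> i. if i \<in> X then axis i 1 - axis (\<phi> i) 1 else axis i 1 :: 'a::comm_ring_1^'v^'v) = 1"
proof -
  obtain d :: "'v \<Rightarrow> nat" where d: "\<And>v. v \<noteq> r \<Longrightarrow> d (\<phi> v) < d v"
    using rooted_at_depthE[OF assms(1)] by blast
  have "finite X" by simp
  then show ?thesis
    using assms(2)
  proof (induction "card X" arbitrary: X)
    case 0
    then have "X = {}" by simp
    then have "(\<chi> i. if i \<in> X then axis i 1 - axis (\<phi> i) 1 else axis i 1 :: 'a^'v^'v) = mat 1"
      by (simp add: vec_eq_iff mat_def axis_def)
    then show ?case by simp
  next
    case (Suc n)
    let ?M = "\<lambda>X. (\<chi> i. if i \<in> X then axis i 1 - axis (\<phi> i) 1 else axis i 1) :: 'a^'v^'v"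
    \<comment> \<open>The parent of a vertex of least depth in \<open>X\<close> has smaller depth,
      hence lies outside \<open>X\<close>.\<close>
    obtain i where i: "i \<in> X" "\<And>j. j \<in> X \<Longrightarrow> d i \<le> d j"
      using ex_min_if_finite[of "d ` X"] Suc.hyps Suc.prems
      by (metis arg_min_if_finite(1) arg_min_least card.empty nat.distinct(1))
    with Suc.prems d[of i] have out: "\<phi> i \<notin> X" "\<phi> i \<noteq> i"
      by (metis leD)+
    \<comment> \<open>The row of \<open>\<phi> i\<close> is still a unit vector, so adding it to row \<open>i\<close> clears that row.\<close>
    have "det (?M (X - {i}))
        = det (\<chi> k. if k = i then row i (?M X) + 1 *s row (\<phi> i) (?M X) else row k (?M X))"
      using i out by (intro arg_cong[of _ _ det]) (auto simp: vec_eq_iff row_def)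
    also have "\<dots> = det (?M X)"
      using out by (intro det_row_operation) auto
    finally have "det (?M X) = det (?M (X - {i}))" ..
    also have "\<dots> = 1"
      using Suc.prems Suc.hyps(2) i by (intro Suc.hyps(1)) auto
    finally show ?case .
  qed
qed

text \<open>The indicator vector of the vertices that never reach \<open>r\<close> lies in the
  kernel: this set is non-empty, avoids \<open>r\<close>, and contains \<open>v\<close> exactly when
  it contains \<open>\<phi> v\<close>.\<close>

lemma det_unrooted:
  fixes \<phi> :: "'v::finite \<Rightarrow> 'v"
  assumes "\<phi> r = r" and "\<not> rooted_at r \<phi>"
  shows "det (\<chi> i. if i \<noteq> r then axis i 1 - axis (\<phi> i) 1 else axis i 1 :: 'a::field^'v^'v) = 0"
proof -
  define C where "C = {v. \<nexists>n. (\<phi> ^^ n) v = r}"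
  have "r \<notin> C"
    unfolding C_def by (auto intro: exI[of _ 0])
  have step: "\<phi> v \<in> C \<longleftrightarrow> v \<in> C" for v
  proof -
    have "(\<exists>n. (\<phi> ^^ n) (\<phi> v) = r) \<longleftrightarrow> (\<exists>n. (\<phi> ^^ n) v = r)"
    proof
      assume "\<exists>n. (\<phi> ^^ n) (\<phi> v) = r"
      then obtain n where "(\<phi> ^^ n) (\<phi> v) = r" ..
      then show "\<exists>n. (\<phi> ^^ n) v = r"
        by (intro exI[of _ "Suc n"]) (simp add: funpow_swap1)
    next
      assume "\<exists>n. (\<phi> ^^ n) v = r"
      then obtain n where "(\<phi> ^^ n) v = r" ..
      \<comment> \<open>One more application of \<open>\<phi>\<close> stays at the fixed point
        \<open>r\<close>.\<close>
      then have "(\<phi> ^^ n) (\<phi> v) = r"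
        using assms(1) by (simp add: funpow_swap1[symmetric])
      then show "\<exists>n. (\<phi> ^^ n) (\<phi> v) = r" ..
    qed
    then show ?thesis
      unfolding C_def by blast
  qed
  define x :: "'a^'v" where "x = (\<chi> v. if v \<in> C then 1 else 0)"
  have axis: "(\<Sum>j\<in>UNIV. axis i 1 $ j * x $ j) = x $ i" for i
    by (simp add: axis_def if_distrib[of "\<lambda>y. y * _"] cong: if_cong)
  have "(\<chi> i. if i \<noteq> r then axis i 1 - axis (\<phi> i) 1 else axis i 1 :: 'a^'v^'v) *v x = 0"
    using \<open>r \<notin> C\<close>
    by (auto simp: vec_eq_iff matrix_vector_mult_def left_diff_distrib sum_subtractf axis)
       (auto simp: x_def step)
  moreover have "x \<noteq> 0"
    using assms unfolding x_def C_def rooted_at_def by (auto simp: vec_eq_iff)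
  ultimately show ?thesis
    by (rule det_eq_0_if_kernel)
qed

section \<open>Spanning trees as parent functions\<close>

text \<open>Two vertices sharing a parent edge would be parents of each other, each of smaller depth
  than the other.\<close>

lemma inj_on_parent_edge:
  fixes \<phi> :: "'v \<Rightarrow> 'v"
  assumes "rooted_at r \<phi>"
  shows "inj_on (\<lambda>v. {v, \<phi> v}) (- {r})"
proof (rule inj_onI)
  obtain d :: "'v \<Rightarrow> nat" where d: "\<And>v. v \<noteq> r \<Longrightarrow> d (\<phi> v) < d v"
    using rooted_at_depthE[OF assms] by blast
  fix u v assume "u \<in> - {r}" "v \<in> - {r}" and eq: "{u, \<phi> u} = {v, \<phi> v}"
  then have "d (\<phi> u) < d u" "d (\<phi> v) < d v"
    using d by auto
  with eq show "u = v"
    by (auto simp: doubleton_eq_iff)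
qed

text \<open>Induction on the depth. If the parents of \<open>v\<close> differ, the edge
  \<open>{v, \<phi> v}\<close> must come from \<open>\<psi> (\<phi> v) = v\<close>; the induction
  hypothesis at \<open>\<phi> v\<close> turns this into \<open>\<phi> (\<phi> v) = v\<close>,
  against the decrease in depth.\<close>

lemma parent_edges_inject:
  fixes \<phi> \<psi> :: "'v \<Rightarrow> 'v"
  assumes \<phi>: "rooted_at r \<phi>" and \<psi>: "rooted_at r \<psi>"
    and eq: "parent_edges r \<phi> = parent_edges r \<psi>"
  shows "\<phi> = \<psi>"
proof
  obtain d :: "'v \<Rightarrow> nat" where d: "\<And>v. v \<noteq> r \<Longrightarrow> d (\<phi> v) < d v"
    using rooted_at_depthE[OF \<phi>] by blast
  have r: "\<phi> r = r" "\<psi> r = r"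
    using \<phi> \<psi> unfolding rooted_at_def by auto
  fix v
  show "\<phi> v = \<psi> v"
  proof (induction "d v" arbitrary: v rule: less_induct)
    case (less v)
    show ?case
    proof (rule ccontr)
      assume ne: "\<phi> v \<noteq> \<psi> v"
      with r have "v \<noteq> r" by auto
      then have "{v, \<phi> v} \<in> parent_edges r \<phi>"
        unfolding parent_edges_def by blast
      then have "{v, \<phi> v} \<in> parent_edges r \<psi>"
        by (simp only: eq)
      with ne have turn: "\<psi> (\<phi> v) = v" "\<phi> v \<noteq> r"
        unfolding parent_edges_def by (auto simp: doubleton_eq_iff)
      have "\<phi> (\<phi> v) = v"
        using less[of "\<phi> v"] d[OF \<open>v \<noteq> r\<close>] turn by simp
      with d[of v] d[of "\<phi> v"] turn \<open>v \<noteq> r\<close> show False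
        by simp
    qed
  qed
qed

lemma graph_connected_parent_edges:
  assumes "rooted_at r \<phi>"
  shows "graph_connected (parent_edges r \<phi>)"
proof -
  let ?R = "adj_rel (parent_edges r \<phi>)"
  have "sym ?R"
    by (auto simp: adj_rel_def sym_def insert_commute)
  have "(v, (\<phi> ^^ n) v) \<in> ?R\<^sup>*" for v n
  proof (induction n)
    case (Suc n)
    let ?u = "(\<phi> ^^ n) v"
    have "(?u, \<phi> ?u) \<in> ?R\<^sup>*"
    proof (cases "?u = r")
      case True
      then show ?thesis using assms unfolding rooted_at_def by simp
    next
      case False
      then show ?thesis
        unfolding adj_rel_def parent_edges_def by blast
    qed
    with Suc show ?case
      by simp
  qed simp
  then have "(v, r) \<in> ?R\<^sup>*" for v
    using assms unfolding rooted_at_def by metis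
  then show ?thesis
    unfolding graph_connected_def
    by (meson \<open>sym ?R\<close> rtrancl_trans sym_def sym_rtrancl)
qed

text \<open>Both neighbours of a deepest vertex on a cycle would have to be its parent.\<close>

lemma graph_acyclic_parent_edges:
  fixes \<phi> :: "'v \<Rightarrow> 'v"
  assumes "rooted_at r \<phi>"
  shows "graph_acyclic (parent_edges r \<phi>)"
  unfolding graph_acyclic_def
proof
  obtain d :: "'v \<Rightarrow> nat" where d: "\<And>v. v \<noteq> r \<Longrightarrow> d (\<phi> v) < d v"
    using rooted_at_depthE[OF assms] by blast
  assume "\<exists>p. is_cycle (parent_edges r \<phi>) p"
  then obtain p where p: "3 \<le> length p" "distinct p"
    and edge: "\<And>i. i < length p \<Longrightarrow> {p ! i, p ! (Suc i mod length p)} \<in> parent_edges r \<phi>"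
    unfolding is_cycle_def by blast
  let ?n = "length p"
  have "Max (d ` set p) \<in> d ` set p"
    using p by (intro Max_in) auto
  then obtain k where k: "k < ?n" and "d (p ! k) = Max (d ` set p)"
    by (metis (no_types, lifting) image_iff in_set_conv_nth)
  then have max: "d (p ! j) \<le> d (p ! k)" if "j < ?n" for j
    using that by simp
  \<comment> \<open>Of the two ends of a parent edge the child is strictly deeper, so a vertex of
    maximal depth has to be the child.\<close>
  have parent: "p ! j = \<phi> (p ! k)" if "j < ?n" "{p ! k, p ! j} \<in> parent_edges r \<phi>" for j
    using that d max[OF that(1)] unfolding parent_edges_def
    by (auto simp: doubleton_eq_iff) (metis leD)
  define j where "j = (if k = 0 then ?n - 1 else k - 1)"
  have j: "j < ?n" "Suc j mod ?n = k"
    using k p by (auto simp: j_def)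
  have s: "Suc k mod ?n < ?n"
    using p by (intro mod_less_divisor) linarith
  have "p ! (Suc k mod ?n) = \<phi> (p ! k)"
    using parent s edge k by blast
  moreover have "p ! j = \<phi> (p ! k)"
    using parent[of j] j edge[of j] by (simp add: insert_commute)
  ultimately have "Suc k mod ?n = j"
    using p j s nth_eq_iff_index_eq by metis
  \<comment> \<open>The cyclic successor and predecessor of \<open>k\<close> differ once the length
    is at least three.\<close>
  then show False
    using p k by (auto simp: j_def mod_Suc split: if_splits)
qed

text \<open>A further edge of \<open>T\<close> would form a cycle with the simple path that joins
  its ends through parent edges.\<close>

lemma tree_eq_parent_edges:
  assumes acyc: "graph_acyclic T" and card2: "\<And>e. e \<in> T \<Longrightarrow> card e = 2"
    and \<phi>: "rooted_at r \<phi>" and sub: "parent_edges r \<phi> \<subseteq> T"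
  shows "T = parent_edges r \<phi>"
proof (rule ccontr)
  assume "T \<noteq> parent_edges r \<phi>"
  then obtain e where e: "e \<in> T" "e \<notin> parent_edges r \<phi>"
    using sub by blast
  then obtain u v where uv: "e = {u, v}" "u \<noteq> v"
    using card2[of e] by (auto simp: card_2_iff)
  let ?P = "\<lambda>x y. {x, y} \<in> parent_edges r \<phi>"
  have "(u, v) \<in> (adj_rel (parent_edges r \<phi>))\<^sup>*"
    using graph_connected_parent_edges[OF \<phi>] unfolding graph_connected_def by blast
  then have "?P\<^sup>*\<^sup>* u v"
    unfolding adj_rel_def rtranclp_rtrancl_eq .
  then obtain xs where "rtrancl_path ?P u xs v"
    unfolding rtranclp_eq_rtrancl_path by blast
  then obtain xs where xs: "rtrancl_path ?P u xs v" "distinct (u # xs)"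
    by (rule rtrancl_path_distinct)
  have "xs \<noteq> []"
    using xs(1) uv by (auto elim: rtrancl_path.cases)
  then have last: "last xs = v"
    using rtrancl_path_last[OF xs(1)] by simp
  have "length xs \<noteq> 1"
  proof
    assume "length xs = 1"
    with last have "xs = [v]"
      by (cases xs) auto
    with rtrancl_path_nth[OF xs(1), of 0] have "{u, v} \<in> parent_edges r \<phi>"
      by simp
    with e uv show False by simp
  qed
  \<comment> \<open>The list \<open>xs\<close> omits the start \<open>u\<close>, so the cycle
    \<open>u # xs\<close> has at least three vertices.\<close>
  with \<open>xs \<noteq> []\<close> have len: "2 \<le> length xs"
    by (cases xs) (auto simp: Suc_le_eq)
  have "{(u # xs) ! i, (u # xs) ! (Suc i mod length (u # xs))} \<in> T" if "i < length (u # xs)" for i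
  \<comment> \<open>At the last index the successor wraps around to \<open>u\<close>, which gives
    the additional edge \<open>e\<close>; the other indices run along the path.\<close>
  proof (cases "i = length xs")
    case True
    then have "(u # xs) ! i = v"
      using last \<open>xs \<noteq> []\<close> by (simp add: last_conv_nth)
    with True e uv show ?thesis
      by (simp add: insert_commute)
  next
    case False
    with that have "i < length xs" by simp
    then show ?thesis
      using rtrancl_path_nth[OF xs(1), of i] sub by auto
  qed
  then have "is_cycle T (u # xs)"
    using len xs unfolding is_cycle_def by simp
  with acyc show False
    unfolding graph_acyclic_def by blast
qed

text \<open>As in breadth-first search, each vertex other than \<open>r\<close> chooses a neighbour
  at smaller distance \<open>d\<close> from \<open>r\<close>.\<close>

lemma connected_parent_function:
  assumes "graph_connected T"
  obtains \<phi> where "rooted_at r \<phi>" and "parent_edges r \<phi> \<subseteq> T"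
proof -
  let ?R = "adj_rel T"
  define d where "d v = (LEAST n. (v, r) \<in> ?R ^^ n)" for v
  have reach: "(v, r) \<in> ?R ^^ d v" for v
  proof -
    have "(v, r) \<in> ?R\<^sup>*"
      using assms unfolding graph_connected_def by blast
    then obtain n where "(v, r) \<in> ?R ^^ n"
      unfolding rtrancl_power by blast
    then show ?thesis
      unfolding d_def by (rule LeastI)
  qed
  have "\<exists>u. {v, u} \<in> T \<and> d u < d v" if "v \<noteq> r" for v
  proof -
    have "d v \<noteq> 0"
      using reach[of v] that by (intro notI) simp
    then obtain m where m: "d v = Suc m"
      using not0_implies_Suc by blast
    then obtain u where u: "(v, u) \<in> ?R" "(u, r) \<in> ?R ^^ m"
      using reach[of v] by (metis relpow_Suc_D2)
    then have "d u \<le> m"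
      unfolding d_def by (intro Least_le)
    with u m show ?thesis
      unfolding adj_rel_def by auto
  qed
  then obtain \<psi> where \<psi>: "\<And>v. v \<noteq> r \<Longrightarrow> {v, \<psi> v} \<in> T \<and> d (\<psi> v) < d v"
    by metis
  \<comment> \<open>The choice of \<open>\<psi>\<close> says nothing about its value at
    \<open>r\<close>, hence the update.\<close>
  have "rooted_at r (\<psi>(r := r))"
    by (rule rooted_at_if_depth[of _ _ d]) (use \<psi> in auto)
  moreover have "parent_edges r (\<psi>(r := r)) \<subseteq> T"
    using \<psi> unfolding parent_edges_def by auto
  ultimately show ?thesis
    by (rule that)
qed

text \<open>A spanning tree contains the parent edges of some rooted function by connectedness, and
  equals them by acyclicity.\<close>

lemma bij_betw_parent_edges:
  assumes "simple_graph E"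
  shows "bij_betw (parent_edges r) {\<phi>. rooted_at r \<phi> \<and> parent_edges r \<phi> \<subseteq> E} (spanning_trees E)"
proof (rule bij_betwI')
  fix \<phi> \<psi>
  assume "\<phi> \<in> {\<phi>. rooted_at r \<phi> \<and> parent_edges r \<phi> \<subseteq> E}" "\<psi> \<in> {\<phi>. rooted_at r \<phi> \<and> parent_edges r \<phi> \<subseteq> E}"
  then show "(parent_edges r \<phi> = parent_edges r \<psi>) = (\<phi> = \<psi>)"
    using parent_edges_inject[of r \<phi> \<psi>] by auto
next
  fix \<phi>
  assume "\<phi> \<in> {\<phi>. rooted_at r \<phi> \<and> parent_edges r \<phi> \<subseteq> E}"
  then show "parent_edges r \<phi> \<in> spanning_trees E"
    by (auto simp: spanning_trees_def graph_connected_parent_edges graph_acyclic_parent_edges)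
next
  fix T
  assume "T \<in> spanning_trees E"
  then have T: "T \<subseteq> E" "graph_connected T" "graph_acyclic T"
    unfolding spanning_trees_def by auto
  then obtain \<phi> where \<phi>: "rooted_at r \<phi>" "parent_edges r \<phi> \<subseteq> T"
    using connected_parent_function[of T r] by blast
  have "T = parent_edges r \<phi>"
    using T \<phi> assms unfolding simple_graph_def by (intro tree_eq_parent_edges) auto
  with T \<phi> show "\<exists>\<phi>\<in>{\<phi>. rooted_at r \<phi> \<and> parent_edges r \<phi> \<subseteq> E}. T = parent_edges r \<phi>"
    by blast
qed

section \<open>The weighted matrix-tree theorem\<close>

definition weighted_laplacian :: "'v::finite set set \<Rightarrow> ('v set \<Rightarrow> complex) \<Rightarrow> complex^'v^'v" where
  "weighted_laplacian E w = weighted_deg E w - weighted_adj E w"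

text \<open>Edges at \<open>i\<close> correspond to neighbours of \<open>i\<close>. The adjacency
  and degree matrices thus have equal row sums, and those of the Laplacian vanish.\<close>

lemma weighted_adj_row_sum:
  assumes "simple_graph E"
  shows "(\<Sum>j\<in>UNIV. weighted_adj E w $ i $ j) = (\<Sum>e | e \<in> E \<and> i \<in> e. w e)"
proof -
  have "(\<Sum>j\<in>UNIV. weighted_adj E w $ i $ j) = (\<Sum>j | {i, j} \<in> E. w {i, j})"
    by (simp add: weighted_adj_def sum.If_cases)
  also have "\<dots> = (\<Sum>e | e \<in> E \<and> i \<in> e. w e)"
  proof (rule sum.reindex_bij_betw)
    show "bij_betw (\<lambda>j. {i, j}) {j. {i, j} \<in> E} {e. e \<in> E \<and> i \<in> e}"
      unfolding bij_betw_def
    proof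
      show "inj_on (\<lambda>j. {i, j}) {j. {i, j} \<in> E}"
        by (auto simp: inj_on_def doubleton_eq_iff)
      have "e \<in> (\<lambda>j. {i, j}) ` {j. {i, j} \<in> E}" if "e \<in> E" "i \<in> e" for e
      proof -
        have "card e = 2"
          using that assms unfolding simple_graph_def by blast
        with that obtain j where "e = {i, j}"
          by (auto simp: card_2_iff)
        with that show ?thesis by blast
      qed
      then show "(\<lambda>j. {i, j}) ` {j. {i, j} \<in> E} = {e. e \<in> E \<and> i \<in> e}"
        by auto
    qed
  qed
  finally show ?thesis .
qed

text \<open>The weighted handshake lemma: each edge is counted at both of its ends.\<close>

lemma sum_weighted_deg:
  assumes "simple_graph E"
  shows "(\<Sum>i\<in>UNIV. \<Sum>e | e \<in> E \<and> i \<in> e. w e) = 2 * total_weight E w"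
proof -
  have "(\<Sum>i\<in>UNIV. \<Sum>e | e \<in> E \<and> i \<in> e. w e) = (\<Sum>e\<in>E. \<Sum>i | i \<in> e. w e)"
    by (subst sum.swap_restrict) auto
  also have "\<dots> = (\<Sum>e\<in>E. 2 * w e)"
    using assms unfolding simple_graph_def by (intro sum.cong) auto
  finally show ?thesis
    by (simp add: total_weight_def sum_distrib_left)
qed

text \<open>In this form, multilinearity of the determinant picks one neighbour \<open>j\<close> for
  each row \<open>i\<close>.\<close>

lemma weighted_laplacian_row:
  assumes "simple_graph E"
  shows "weighted_laplacian E w $ i
       = (\<Sum>j\<in>UNIV. weighted_adj E w $ i $ j *s (axis i 1 - axis j 1))"
proof (rule vec_eq_iff[THEN iffD2], rule allI)
  fix k
  have "(\<Sum>j\<in>UNIV. weighted_adj E w $ i $ j *s (axis i 1 - axis j 1)) $ k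
      = (\<Sum>j\<in>UNIV. weighted_adj E w $ i $ j) * axis i 1 $ k
        - (\<Sum>j\<in>UNIV. weighted_adj E w $ i $ j * axis j 1 $ k)"
    by (simp add: sum_component right_diff_distrib sum_subtractf sum_distrib_right)
  also have "(\<Sum>j\<in>UNIV. weighted_adj E w $ i $ j * axis j 1 $ k) = weighted_adj E w $ i $ k"
    by (simp add: axis_def if_distrib[of "(*) _"] cong: if_cong)
  also have "(\<Sum>j\<in>UNIV. weighted_adj E w $ i $ j) * axis i 1 $ k = weighted_deg E w $ i $ k"
    unfolding weighted_adj_row_sum[OF assms] by (simp add: weighted_deg_def axis_def)
  finally show "weighted_laplacian E w $ i $ k
      = (\<Sum>j\<in>UNIV. weighted_adj E w $ i $ j *s (axis i 1 - axis j 1)) $ k"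
    by (simp add: weighted_laplacian_def)
qed

text \<open>With \<open>axis r 1\<close> as row \<open>r\<close>, the determinant is the principal
  minor of the Laplacian at \<open>r\<close>.\<close>

theorem weighted_matrix_tree:
  fixes E :: "'v::finite set set"
  assumes "simple_graph E"
  shows "det (\<chi> i. if i = r then axis r 1 else weighted_laplacian E w $ i)
       = (\<Sum>T\<in>spanning_trees E. \<Prod>e\<in>T. w e)"
proof -
  let ?G = "{\<phi>. rooted_at r \<phi> \<and> parent_edges r \<phi> \<subseteq> E}"
  \<comment> \<open>Row \<open>r\<close> is also written as a sum over \<open>j\<close>, with its
    only nonzero coefficient at \<open>j = r\<close>, so that the surviving choice functions fix the
    root.\<close>
  define c where "c i j = (if i = r then if j = r then 1 else 0 else weighted_adj E w $ i $ j)" for i j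
  define a :: "'v \<Rightarrow> 'v \<Rightarrow> complex^'v"
    where "a i j = (if i \<noteq> r then axis i 1 - axis j 1 else axis i 1)" for i j
  have "(if i = r then axis r 1 else weighted_laplacian E w $ i) = (\<Sum>j\<in>UNIV. c i j *s a i j)" for i
  proof (cases "i = r")
    case True
    then have "(\<Sum>j\<in>UNIV. c i j *s a i j) = (\<Sum>j\<in>UNIV. if j = r then axis r 1 else 0)"
      by (intro sum.cong) (auto simp: c_def a_def)
    with True show ?thesis by simp
  next
    case False
    then show ?thesis
      by (simp add: weighted_laplacian_row[OF assms] c_def a_def)
  qed
  then have "det (\<chi> i. if i = r then axis r 1 else weighted_laplacian E w $ i)
      = det (\<chi> i. \<Sum>j\<in>UNIV. c i j *s a i j)"
    by simp
  also have "\<dots> = (\<Sum>\<phi>\<in>UNIV. det (\<chi> i. c i (\<phi> i) *s a i (\<phi> i)))"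
    by (subst det_linear_rows_sum) simp_all
  also have "\<dots> = (\<Sum>\<phi>\<in>UNIV. (\<Prod>i\<in>UNIV. c i (\<phi> i)) * det (\<chi> i. a i (\<phi> i)))"
    by (simp add: det_rows_mul)
  also have "\<dots> = (\<Sum>\<phi>\<in>?G. (\<Prod>i\<in>UNIV. c i (\<phi> i)) * det (\<chi> i. a i (\<phi> i)))"
  proof (rule sum.mono_neutral_right)
    show "\<forall>\<phi>\<in>UNIV - ?G. (\<Prod>i\<in>UNIV. c i (\<phi> i)) * det (\<chi> i. a i (\<phi> i)) = 0"
    proof
      fix \<phi> assume \<phi>: "\<phi> \<in> UNIV - ?G"
      \<comment> \<open>In the first and third case a coefficient vanishes; in the second the
        selected rows are linearly dependent.\<close>
      consider "\<phi> r \<noteq> r" | "\<phi> r = r" "\<not> rooted_at r \<phi>" | i where "i \<noteq> r" "{i, \<phi> i} \<notin> E"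
        using \<phi> unfolding parent_edges_def by blast
      then show "(\<Prod>i\<in>UNIV. c i (\<phi> i)) * det (\<chi> i. a i (\<phi> i)) = 0"
      proof cases
        case 1
        then have "c r (\<phi> r) = 0" by (simp add: c_def)
        then show ?thesis by (auto simp: prod_zero_iff)
      next
        case 2
        then show ?thesis unfolding a_def by (subst det_unrooted) auto
      next
        case 3
        then have "c i (\<phi> i) = 0" by (simp add: c_def weighted_adj_def)
        then show ?thesis by (auto simp: prod_zero_iff)
      qed
    qed
  qed auto
  also have "\<dots> = (\<Sum>\<phi>\<in>?G. \<Prod>e\<in>parent_edges r \<phi>. w e)"
  proof (rule sum.cong)
    fix \<phi> assume \<phi>: "\<phi> \<in> ?G"
    have "det (\<chi> i. a i (\<phi> i)) = 1"
      using det_rooted[of r \<phi> "- {r}"] \<phi> unfolding a_def by simp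
    moreover have "(\<Prod>i\<in>UNIV. c i (\<phi> i)) = (\<Prod>i\<in>- {r}. w {i, \<phi> i})"
    proof -
      have "(\<Prod>i\<in>UNIV. c i (\<phi> i)) = c r (\<phi> r) * (\<Prod>i\<in>UNIV - {r}. c i (\<phi> i))"
        by (rule prod.remove) auto
      also have "c r (\<phi> r) = 1"
        using \<phi> by (simp add: c_def rooted_at_def)
      also have "(\<Prod>i\<in>UNIV - {r}. c i (\<phi> i)) = (\<Prod>i\<in>- {r}. w {i, \<phi> i})"
        using \<phi> by (intro prod.cong) (auto simp: c_def weighted_adj_def parent_edges_def)
      finally show ?thesis by simp
    qed
    moreover have "(\<Prod>e\<in>parent_edges r \<phi>. w e) = (\<Prod>i\<in>- {r}. w {i, \<phi> i})"
      using \<phi> unfolding parent_edges_def by (subst prod.reindex) (auto intro: inj_on_parent_edge)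
    ultimately show "(\<Prod>i\<in>UNIV. c i (\<phi> i)) * det (\<chi> i. a i (\<phi> i)) = (\<Prod>e\<in>parent_edges r \<phi>. w e)"
      by simp
  qed simp
  also have "\<dots> = (\<Sum>T\<in>spanning_trees E. \<Prod>e\<in>T. w e)"
    using bij_betw_parent_edges[OF assms] by (rule sum.reindex_bij_betw)
  finally show ?thesis .
qed

section \<open>Derivatives of the generalized characteristic function\<close>

text \<open>The curve \<open>(p t, q t)\<close> lets one statement cover both partial derivatives.
  As \<open>w\<close> is arbitrary, the result can later be differentiated in
  \<open>x\<close>.\<close>

lemma has_field_derivative_gen_charfun:
  fixes E :: "'v::finite set set" and p q :: "complex \<Rightarrow> complex"
  assumes E: "simple_graph E"
    and f: "((\<lambda>t. f (p t) (q t)) has_field_derivative f') (at a)"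
    and g: "((\<lambda>t. g (p t) (q t)) has_field_derivative g') (at a)"
    and h: "((\<lambda>t. h (p t) (q t)) has_field_derivative h') (at a)"
    and f0: "f (p a) (q a) = 0" and gh0: "g (p a) (q a) + h (p a) (q a) = 0"
  shows "((\<lambda>t. gen_charfun f g h E w (p t) (q t)) has_field_derivative
      g (p a) (q a) ^ (CARD('v) - 1) * (f' * of_nat CARD('v) + (g' + h') * 2 * total_weight E w)
        * (\<Sum>T\<in>spanning_trees E. \<Prod>e\<in>T. w e)) (at a)"
proof -
  let ?g = "g (p a) (q a)" and ?L = "weighted_laplacian E w"
  let ?\<kappa> = "\<Sum>T\<in>spanning_trees E. \<Prod>e\<in>T. w e"
  define A where "A t = map_matrix ((*) (f (p t) (q t))) (mat 1)
    + map_matrix ((*) (g (p t) (q t))) (weighted_deg E w)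
    + map_matrix ((*) (h (p t) (q t))) (weighted_adj E w)" for t
  define A' where "A' = map_matrix ((*) f') (mat 1)
    + map_matrix ((*) g') (weighted_deg E w) + map_matrix ((*) h') (weighted_adj E w)"
  have "h (p a) (q a) = - ?g"
    using gh0 by (simp add: eq_neg_iff_add_eq_0 add.commute)
  then have Aa: "A a $ k = ?g *s ?L $ k" for k
    using f0 by (simp add: A_def weighted_laplacian_def vec_eq_iff algebra_simps)
  have deg_sum: "(\<Sum>j\<in>UNIV. weighted_deg E w $ i $ j) = (\<Sum>e | e \<in> E \<and> i \<in> e. w e)" for i
    by (simp add: weighted_deg_def)
  have L_sum: "(\<Sum>j\<in>UNIV. A a $ i $ j) = 0" for i
    unfolding Aa
    by (simp add: weighted_laplacian_def sum_subtractf deg_sum weighted_adj_row_sum[OF E]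
        flip: sum_distrib_left)
  have A'_sum: "(\<Sum>j\<in>UNIV. A' $ i $ j) = f' + (g' + h') * (\<Sum>e | e \<in> E \<and> i \<in> e. w e)" for i
  proof -
    have "(\<Sum>j\<in>UNIV. (mat 1 :: complex^'v^'v) $ i $ j) = 1"
      by (simp add: mat_def)
    then show ?thesis
      by (simp add: A'_def sum.distrib deg_sum weighted_adj_row_sum[OF E] distrib_right
          flip: sum_distrib_left)
  qed
  \<comment> \<open>Every row except row \<open>i\<close> carries a factor \<open>?g\<close>, whence
    the exponent.\<close>
  have minor: "det (\<chi> k. if k = i then axis i 1 else A a $ k) = ?g ^ (CARD('v) - 1) * ?\<kappa>" for i
  proof -
    have "(\<chi> k. if k = i then axis i 1 else A a $ k)
        = (\<chi> k. (if k = i then 1 else ?g) *s (if k = i then axis i 1 else ?L $ k))"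
      by (simp add: vec_eq_iff Aa)
    moreover have "(\<Prod>k\<in>UNIV. if k = i then 1 else ?g) = ?g ^ (CARD('v) - 1)"
      by (subst prod.remove[of _ i]) (simp_all add: card_Diff_singleton)
    ultimately show ?thesis
      by (simp only: det_rows_mul weighted_matrix_tree[OF E])
  qed
  have "((\<lambda>t. A t $ i $ j) has_field_derivative A' $ i $ j) (at a)" for i j
    unfolding A_def A'_def by (auto intro!: derivative_eq_intros f g h)
  then have "((\<lambda>t. det (A t)) has_field_derivative
      (\<Sum>i\<in>UNIV. det (\<chi> k. if k = i then A' $ k else A a $ k))) (at a)"
    by (rule has_field_derivative_det)
  also have "(\<Sum>i\<in>UNIV. det (\<chi> k. if k = i then A' $ k else A a $ k))
      = (\<Sum>i\<in>UNIV. (f' + (g' + h') * (\<Sum>e | e \<in> E \<and> i \<in> e. w e)) * (?g ^ (CARD('v) - 1) * ?\<kappa>))"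
  proof (rule sum.cong)
    fix i
    \<comment> \<open>The replacement row has to be a vector independent of \<open>k\<close> for
      \<open>det_replace_row_zero_sums\<close> to apply.\<close>
    have "(\<chi> k. if k = i then A' $ k else A a $ k) = (\<chi> k. if k = i then A' $ i else A a $ k)"
      by (simp add: vec_eq_iff)
    then show "det (\<chi> k. if k = i then A' $ k else A a $ k)
        = (f' + (g' + h') * (\<Sum>e | e \<in> E \<and> i \<in> e. w e)) * (?g ^ (CARD('v) - 1) * ?\<kappa>)"
      by (simp add: det_replace_row_zero_sums[OF L_sum, where b = "A' $ i"] A'_sum minor)
  qed simp
  also have "\<dots> = (f' * of_nat CARD('v) + (g' + h') * (2 * total_weight E w)) * (?g ^ (CARD('v) - 1) * ?\<kappa>)"
    unfolding sum_weighted_deg[OF E, symmetric]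
    by (simp add: sum.distrib mult.commute flip: sum_distrib_left sum_distrib_right)
  finally show ?thesis
    unfolding gen_charfun_def A_def[symmetric] by (simp add: mult_ac)
qed

text \<open>The point \<open>1\<close> lies off the branch cut, and the factor
  \<open>x powr (w e - 1)\<close> in the derivative equals \<open>1\<close> there.\<close>

lemma has_field_derivative_power_weight_at_1:
  "((\<lambda>x. power_weight w x e) has_field_derivative w e) (at 1)"
  unfolding power_weight_def
  by (rule DERIV_cong[OF has_field_derivative_powr]) auto

text \<open>The product rule in \<open>x\<close> is applied to the derivative in \<open>t\<close>.
  At \<open>x = 1\<close> all edge weights are \<open>1\<close>, so the tree sum and the total
  weight become \<open>complexity E\<close> and \<open>card E\<close>, while their derivatives are
  \<open>sigma_complexity E w\<close> and \<open>total_weight E w\<close>.\<close>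

lemma has_mixed_partial_gen_charfun:
  fixes E :: "'v::finite set set" and p q :: "complex \<Rightarrow> complex"
  assumes "simple_graph E"
    and "((\<lambda>t. f (p t) (q t)) has_field_derivative f') (at a)"
    and "((\<lambda>t. g (p t) (q t)) has_field_derivative g') (at a)"
    and "((\<lambda>t. h (p t) (q t)) has_field_derivative h') (at a)"
    and "f (p a) (q a) = 0" and "g (p a) (q a) + h (p a) (q a) = 0"
  shows "has_mixed_partial (\<lambda>t x. gen_charfun f g h E (power_weight w x) (p t) (q t))
      (g (p a) (q a) ^ (CARD('v) - 1) * (g' + h') * 2 * total_weight E w * of_nat (complexity E)
       + g (p a) (q a) ^ (CARD('v) - 1)
         * (f' * of_nat CARD('v) + (g' + h') * 2 * of_nat (card E)) * sigma_complexity E w) a 1"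
proof -
  let ?c = "g (p a) (q a) ^ (CARD('v) - 1)"
  let ?W = "\<lambda>x. total_weight E (power_weight w x)"
  let ?K = "\<lambda>x. \<Sum>T\<in>spanning_trees E. \<Prod>e\<in>T. power_weight w x e"
  \<comment> \<open>The weight function stays schematic in \<open>D\<close>, so the formula is
    available at every \<open>x\<close>.\<close>
  note D = has_field_derivative_gen_charfun[where f = f and g = g and h = h and p = p and q = q and a = a, OF assms]
  have one: "power_weight w 1 e = 1" for e
    by (simp add: power_weight_def)
  have W: "(?W has_field_derivative total_weight E w) (at 1)"
    unfolding total_weight_def by (intro DERIV_sum has_field_derivative_power_weight_at_1)
  have K: "(?K has_field_derivative sigma_complexity E w) (at 1)"
  proof -
    have "(?K has_field_derivative
        (\<Sum>T\<in>spanning_trees E. \<Sum>e\<in>T. w e * (\<Prod>e'\<in>T - {e}. power_weight w 1 e'))) (at 1)"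
      by (intro DERIV_sum has_field_derivative_prod has_field_derivative_power_weight_at_1)
    then show ?thesis
      by (simp add: one sigma_complexity_def)
  qed
  have "((\<lambda>x. ?c * (f' * of_nat CARD('v) + (g' + h') * 2 * ?W x) * ?K x) has_field_derivative
      ?c * ((g' + h') * 2 * total_weight E w) * ?K 1
      + ?c * (f' * of_nat CARD('v) + (g' + h') * 2 * ?W 1) * sigma_complexity E w) (at 1)"
    by (rule DERIV_cong[OF DERIV_mult[OF DERIV_cmult[OF DERIV_add[OF DERIV_const DERIV_cmult[OF W]]] K]])
       (simp add: algebra_simps)
  moreover have "?K 1 = of_nat (complexity E)" and "?W 1 = of_nat (card E)"
    by (simp_all add: one complexity_def total_weight_def)
  ultimately have "((\<lambda>x. ?c * (f' * of_nat CARD('v) + (g' + h') * 2 * ?W x) * ?K x) has_field_derivative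
      ?c * (g' + h') * 2 * total_weight E w * of_nat (complexity E)
      + ?c * (f' * of_nat CARD('v) + (g' + h') * 2 * of_nat (card E)) * sigma_complexity E w) (at 1)"
    by (simp only: mult.assoc)
  moreover have "(\<lambda>t. gen_charfun f g h E (power_weight w x) (p t) (q t)) field_differentiable at a" for x
    using D unfolding field_differentiable_def by blast
  ultimately show ?thesis
    unfolding has_mixed_partial_def DERIV_imp_deriv[OF D] by simp
qed

theorem theorem1p3:
  fixes E :: "'v::finite set set" and \<omega> :: "'v set \<Rightarrow> complex"
    and f g h :: "complex \<Rightarrow> complex \<Rightarrow> complex"
    and S :: "(complex \<times> complex) set" and \<alpha> \<beta> :: complex
  assumes "simple_graph E"
    and "open S" and "(\<alpha>, \<beta>) \<in> S"
    and "partially_differentiable_on f S" and "partially_differentiable_on g S"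
    and "partially_differentiable_on h S"
    and "f \<alpha> \<beta> = 0" and "g \<alpha> \<beta> + h \<alpha> \<beta> = 0"
  shows "has_mixed_partial (\<lambda>l x. gen_charfun f g h E (power_weight \<omega> x) l \<beta>)
      (g \<alpha> \<beta> ^ (CARD('v) - 1) * (pderiv1 g \<alpha> \<beta> + pderiv1 h \<alpha> \<beta>)
         * 2 * total_weight E \<omega> * of_nat (complexity E)
       + g \<alpha> \<beta> ^ (CARD('v) - 1)
         * (pderiv1 f \<alpha> \<beta> * of_nat CARD('v)
            + (pderiv1 g \<alpha> \<beta> + pderiv1 h \<alpha> \<beta>) * 2 * of_nat (card E))
         * sigma_complexity E \<omega>) \<alpha> 1
    \<and> has_mixed_partial (\<lambda>m x. gen_charfun f g h E (power_weight \<omega> x) \<alpha> m)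
      (g \<alpha> \<beta> ^ (CARD('v) - 1) * (pderiv2 g \<alpha> \<beta> + pderiv2 h \<alpha> \<beta>)
         * 2 * total_weight E \<omega> * of_nat (complexity E)
       + g \<alpha> \<beta> ^ (CARD('v) - 1)
         * (pderiv2 f \<alpha> \<beta> * of_nat CARD('v)
            + (pderiv2 g \<alpha> \<beta> + pderiv2 h \<alpha> \<beta>) * 2 * of_nat (card E))
         * sigma_complexity E \<omega>) \<beta> 1"
proof -
  have deriv: "((\<lambda>l. k l \<beta>) has_field_derivative pderiv1 k \<alpha> \<beta>) (at \<alpha>)"
    "((\<lambda>m. k \<alpha> m) has_field_derivative pderiv2 k \<alpha> \<beta>) (at \<beta>)"
    if "partially_differentiable_on k S" for k
    using that \<open>(\<alpha>, \<beta>) \<in> S\<close>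
    unfolding partially_differentiable_on_def pderiv1_def pderiv2_def
    by (auto simp: DERIV_deriv_iff_field_differentiable)
  note f = deriv[OF assms(4)] and g = deriv[OF assms(5)] and h = deriv[OF assms(6)]
  \<comment> \<open>The two partial derivatives are taken along the lines
    \<open>(t, \<beta>)\<close> and \<open>(\<alpha>, t)\<close>.\<close>
  show ?thesis
    using has_mixed_partial_gen_charfun[where f = f and g = g and h = h and p = "\<lambda>t. t" and q = "\<lambda>_. \<beta>",
        OF assms(1) f(1) g(1) h(1) assms(7,8), of \<omega>]
      has_mixed_partial_gen_charfun[where f = f and g = g and h = h and p = "\<lambda>_. \<alpha>" and q = "\<lambda>t. t",
        OF assms(1) f(2) g(2) h(2) assms(7,8), of \<omega>]
    by blast
qed

end
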